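(* Consider an instance of the maintenance scheduling problem without storage nodes, i.e. $W=\varnothing$. For each $a\in A_1$ let $S_0(a)=\{r_a,\,d_a-p_a\}$, and define recursively for integers $k\geqslant 0$ $$S_{k+1}(a)=S_k(a)\cup\bigcup_{a'\in A_1\setminus\{a\}}\Big(\big(S_k(a')\cup(S_k(a')+p_{a'})\cup(S_k(a')-p_a)\cup(S_k(a')+p_{a'}-p_a)\big)\cap[r_a,\,d_a-p_a]\Big),$$ and $S(a)=S_{|A_1|-1}(a)$. Then there is an optimal solution $t^*=(t^*_a)_{a\in A_1}$ of the problem $\varphi^*=\max\{\operatorname{val}(t^* ) : t^*\in X\}$ such that $t^*_a\in S(a)$ for each $a\in A_1$.
   Context: For $Y\subseteq\mathbb{R}$ and $\lambda\in\mathbb{R}$, $Y+\lambda=\{y+\lambda : y\in Y\}$. The maintenance scheduling problem. $N=(V,A,s,t)$ is a finite directed network (parallel arcs allowed) with distinct source $s$ and sink $t$; $\delta^{\text{out}}(v)$ and $\delta^{\text{in}}(v)$ are the sets of arcs starting, respectively ending, at $v$. $W\subseteq V\setminus\{s,t\}$ is a set of storage nodes, and $u=(u_x)_{x\in A\cup W}$ are nonnegative capacities (flow per unit time for arcs, stored amount for nodes in $W$). $T>0$ is the time horizon. $A_1\subseteq A$ is the set of arcs with a maintenance job; each $a\in A_1$ has exactly one job, with processing time $p_a>0$, release time $r_a$ and deadline $d_a$, where $0\leqslant r_a\leqslant d_a-p_a$ and $d_a\leqslant T$. A feasible solution is a start time vector $t^*=(t^*_a)_{a\in A_1}\in X:=\prod_{a\in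 A_1}[r_a,d_a-p_a]$. Value of a solution. Given $t^*\in X$, let $0=t_0<t_1<\cdots<t_n=T$ be the increasing enumeration of the set $\{t^*_a : a\in A_1\}\cup\{t^*_a+p_a : a\in A_1\}\cup\{0,T\}$, and for $a\in A_1$ let $I_a=\{i\in\{1,\dots,n\} : t^*_a<t_i\leqslant t^*_a+p_a\}$. Then $\operatorname{val}(t^* )$ is the maximum of $\sum_{i=1}^n\big(\sum_{a\in\delta^{\text{out}}(s)}x_{ai}-\sum_{a\in\delta^{\text{in}}(s)}x_{ai}\big)$ over all nonnegative reals $x_{ai}$ ($a\in A$, $1\leqslant i\leqslant n$) and $x_{vi}$ ($v\in W$, $0\leqslant i\leqslant n$) satisfying: $\sum_{a\in\delta^{\text{out}}(v)}x_{ai}=\sum_{a\in\delta^{\text{in}}(v)}x_{ai}$ for $v\in V\setminus(W\cup\{s,t\})$, $1\leqslant i\leqslant n$; $\sum_{a\in\delta^{\text{out}}(v)}x_{ai}+x_{vi}=\sum_{a\in\delta^{\text{in}}(v)}x_{ai}+x_{v,i-1}$ for $v\in W$, $1\leqslant i\leqslant n$; $x_{ai}\leqslant(t_i-t_{i-1})u_a$ for $a\in A\setminus A_1$ and all $i$, and for $a\in A_1$ and $i\notin I_a$; $x_{ai}=0$ for $a\in A_1$, $i\in I_a$; $x_{vi}\leqslant u_v$ for $v\in W$, $0\leqslant i\leqslant n$; $x_{v0}=x_{vn}=0$ for $v\in W$. The problem is to determine $\varphi^*=\max\{\operatorname{val}(t^* ) : t^*\in X\}$; an optimal solution is a $t^*\in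 X$ attaining this maximum. *)

theory Defs
  imports "HOL-Analysis.Analysis" "Graph_Theory.Digraph"
begin

record ('v, 'a) maintenance_data =
  network :: "('v, 'a) pre_digraph"
  source :: 'v
  sink :: 'v
  storage :: "'v set"
  arc_cap :: "'a \<Rightarrow> real"
  node_cap :: "'v \<Rightarrow> real"
  horizon :: real
  jobs :: "'a set"
  proc_time :: "'a \<Rightarrow> real"
  release :: "'a \<Rightarrow> real"
  deadline :: "'a \<Rightarrow> real"

text \<open>
  A job is identified with its arc, since every arc carries at most one job. The capacity
  vector, indexed by arcs and storage nodes, is split into \<open>arc_cap\<close> and \<open>node_cap\<close>.
  Parallel arcs (and loops) are allowed by \<open>fin_digraph\<close>.
\<close>

definition maintenance_instance :: "('v, 'a) maintenance_data \<Rightarrow> bool" where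
  "maintenance_instance I \<longleftrightarrow>
     fin_digraph (network I) \<and>
     source I \<in> verts (network I) \<and> sink I \<in> verts (network I) \<and> source I \<noteq> sink I \<and>
     storage I \<subseteq> verts (network I) - {source I, sink I} \<and>
     (\<forall>a\<in>arcs (network I). 0 \<le> arc_cap I a) \<and>
     (\<forall>v\<in>storage I. 0 \<le> node_cap I v) \<and>
     0 < horizon I \<and>
     jobs I \<subseteq> arcs (network I) \<and>
     (\<forall>a\<in>jobs I. 0 < proc_time I a \<and> 0 \<le> release I a \<and>
        release I a \<le> deadline I a - proc_time I a \<and> deadline I a \<le> horizon I)"

definition start_window :: "('v, 'a) maintenance_data \<Rightarrow> 'a \<Rightarrow> real set" where
  "start_window I a = {release I a .. deadline I a - proc_time I a}"

definition schedules :: "('v, 'a) maintenance_data \<Rightarrow> ('a \<Rightarrow> real) set" where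
  "schedules I = (\<Pi>\<^sub>E a\<in>jobs I. start_window I a)"

definition event_times :: "('v, 'a) maintenance_data \<Rightarrow> ('a \<Rightarrow> real) \<Rightarrow> real set" where
  "event_times I ts = ts ` jobs I \<union> (\<lambda>a. ts a + proc_time I a) ` jobs I \<union> {0, horizon I}"

text \<open>
  \<open>event_time I ts i\<close> is the \<open>i\<close>-th smallest event time for \<open>0 \<le> i \<le> num_intervals I ts\<close>;
  outside this range it is unspecified and never used.
\<close>

definition event_time :: "('v, 'a) maintenance_data \<Rightarrow> ('a \<Rightarrow> real) \<Rightarrow> nat \<Rightarrow> real" where
  "event_time I ts i = sorted_list_of_set (event_times I ts) ! i"

definition num_intervals :: "('v, 'a) maintenance_data \<Rightarrow> ('a \<Rightarrow> real) \<Rightarrow> nat" where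
  "num_intervals I ts = card (event_times I ts) - 1"

definition maintained :: "('v, 'a) maintenance_data \<Rightarrow> ('a \<Rightarrow> real) \<Rightarrow> 'a \<Rightarrow> nat set" where
  "maintained I ts a = {i \<in> {1..num_intervals I ts}.
     ts a < event_time I ts i \<and> event_time I ts i \<le> ts a + proc_time I a}"

text \<open>
  In the following, \<open>x a i\<close> is the amount of flow on arc \<open>a\<close> in the \<open>i\<close>-th interval and
  \<open>y v i\<close> the amount stored at node \<open>v\<close> at the \<open>i\<close>-th event time. Values at other arguments
  are irrelevant.
\<close>

definition feasible_flow ::
  "('v, 'a) maintenance_data \<Rightarrow> ('a \<Rightarrow> real) \<Rightarrow> ('a \<Rightarrow> nat \<Rightarrow> real) \<Rightarrow> ('v \<Rightarrow> nat \<Rightarrow> real) \<Rightarrow> bool" where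
  "feasible_flow I ts x y \<longleftrightarrow>
     (let G = network I; W = storage I; n = num_intervals I ts in
       (\<forall>a\<in>arcs G. \<forall>i\<in>{1..n}. 0 \<le> x a i) \<and>
       (\<forall>v\<in>W. \<forall>i\<in>{0..n}. 0 \<le> y v i) \<and>
       (\<forall>v\<in>verts G - (W \<union> {source I, sink I}). \<forall>i\<in>{1..n}.
          (\<Sum>a\<in>out_arcs G v. x a i) = (\<Sum>a\<in>in_arcs G v. x a i)) \<and>
       (\<forall>v\<in>W. \<forall>i\<in>{1..n}.
          (\<Sum>a\<in>out_arcs G v. x a i) + y v i = (\<Sum>a\<in>in_arcs G v. x a i) + y v (i - 1)) \<and>
       (\<forall>a\<in>arcs G. \<forall>i\<in>{1..n}. a \<notin> jobs I \<or> i \<notin> maintained I ts a \<longrightarrow>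
          x a i \<le> (event_time I ts i - event_time I ts (i - 1)) * arc_cap I a) \<and>
       (\<forall>a\<in>jobs I. \<forall>i\<in>maintained I ts a. x a i = 0) \<and>
       (\<forall>v\<in>W. \<forall>i\<in>{0..n}. y v i \<le> node_cap I v) \<and>
       (\<forall>v\<in>W. y v 0 = 0 \<and> y v n = 0))"

definition throughput ::
  "('v, 'a) maintenance_data \<Rightarrow> ('a \<Rightarrow> real) \<Rightarrow> ('a \<Rightarrow> nat \<Rightarrow> real) \<Rightarrow> real" where
  "throughput I ts x = (\<Sum>i = 1..num_intervals I ts.
     (\<Sum>a\<in>out_arcs (network I) (source I). x a i) - (\<Sum>a\<in>in_arcs (network I) (source I). x a i))"

text \<open>
  The maximum exists for every schedule of a valid instance: zero flow is feasible, and up to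
  irrelevant values the feasible flows form a compact polytope.
\<close>

definition schedule_value :: "('v, 'a) maintenance_data \<Rightarrow> ('a \<Rightarrow> real) \<Rightarrow> real" where
  "schedule_value I ts = (GREATEST z. \<exists>x y. feasible_flow I ts x y \<and> z = throughput I ts x)"

definition optimal_schedule :: "('v, 'a) maintenance_data \<Rightarrow> ('a \<Rightarrow> real) \<Rightarrow> bool" where
  "optimal_schedule I ts \<longleftrightarrow> ts \<in> schedules I \<and>
     (\<forall>ts'\<in>schedules I. schedule_value I ts' \<le> schedule_value I ts)"

definition translate :: "real set \<Rightarrow> real \<Rightarrow> real set" where
  "translate Y c = {y + c | y. y \<in> Y}"

primrec candidates :: "('v, 'a) maintenance_data \<Rightarrow> nat \<Rightarrow> 'a \<Rightarrow> real set" where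
  "candidates I 0 = (\<lambda>a. {release I a, deadline I a - proc_time I a})"
| "candidates I (Suc k) = (\<lambda>a. candidates I k a \<union>
     (\<Union>b\<in>jobs I - {a}.
        (candidates I k b \<union>
         translate (candidates I k b) (proc_time I b) \<union>
         translate (candidates I k b) (- proc_time I a) \<union>
         translate (candidates I k b) (proc_time I b - proc_time I a))
        \<inter> start_window I a))"

text \<open>
  The truncated subtraction is harmless: without jobs there is no arc to which the candidate
  sets are applied.
\<close>

definition candidate_starts :: "('v, 'a) maintenance_data \<Rightarrow> 'a \<Rightarrow> real set" where
  "candidate_starts I a = candidates I (card (jobs I) - 1) a"

end

theory Submission
  imports Defs
begin

text \<open>
  Without storage the flow can be chosen independently at each moment, so the value of a schedule
  is the integral over time of the maximum flow value in the network that lacks the arcs under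
  maintenance. Let \<open>C\<close> be a set of jobs none of which sits at an end of its window, and none of
  whose start or end times is shared with a job outside \<open>C\<close>. Shifting all of \<open>C\<close> by \<open>l\<close> changes
  the value by \<open>l * K\<close> with a constant \<open>K\<close>, until an event of \<open>C\<close> meets an event of another job
  or a job of \<open>C\<close> reaches the end of its window. So \<open>C\<close> can be moved to such a critical position
  without loss, which creates a new coincidence and destroys none. In a schedule that admits no
  further move, every job is linked by at most \<open>card (jobs I) - 1\<close> coincidences to a job at an end
  of its window, hence starts at a candidate time. As there are finitely many such schedules, one of
  them is optimal.
\<close>

text \<open>Breakpoints may coincide and the values of \<open>g\<close> at them do not matter, since
  each piece is constant only on the open interval. The conjunct \<open>f 0 \<le> f n\<close> is
  carried along because joining the next piece in the induction requires it.\<close>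

lemma has_integral_step_function:
  fixes f c :: "nat \<Rightarrow> real" and g :: "real \<Rightarrow> real"
  assumes "\<And>i. i \<in> {1..n} \<Longrightarrow> f (i - 1) \<le> f i"
    and "\<And>i t. \<lbrakk>i \<in> {1..n}; f (i - 1) < t; t < f i\<rbrakk> \<Longrightarrow> g t = c i"
  shows "f 0 \<le> f n \<and> (g has_integral (\<Sum>i = 1..n. (f i - f (i - 1)) * c i)) {f 0..f n}"
  using assms
proof (induction n)
  case 0
  show ?case using has_integral_refl(2)[of g "f 0"] by (simp add: cbox_interval)
next
  case (Suc n)
  have IH: "f 0 \<le> f n" "(g has_integral (\<Sum>i = 1..n. (f i - f (i - 1)) * c i)) {f 0..f n}"
    using Suc.IH Suc.prems by auto
  have le: "f n \<le> f (Suc n)" using Suc.prems(1)[of "Suc n"] by simp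
  have eq: "g t = c (Suc n)" if "f n < t" "t < f (Suc n)" for t
    using Suc.prems(2)[of "Suc n" t] that by simp
  have "((\<lambda>_. c (Suc n)) has_integral (f (Suc n) - f n) * c (Suc n)) (cbox (f n) (f (Suc n)))"
    using has_integral_const_real[of "c (Suc n)" "f n" "f (Suc n)"] le by (simp add: cbox_interval)
  then have "(g has_integral (f (Suc n) - f n) * c (Suc n)) (cbox (f n) (f (Suc n)))"
    by (rule has_integral_spike_interior) (use eq in \<open>auto simp: box_real\<close>)
  then have "(g has_integral (\<Sum>i = 1..n. (f i - f (i - 1)) * c i) + (f (Suc n) - f n) * c (Suc n))
      {f 0..f (Suc n)}"
    using has_integral_combine[OF IH(1) le IH(2)] by (simp add: cbox_interval)
  then show ?case using IH(1) le by simp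
qed

locale storage_free_maintenance =
  fixes I :: "('v, 'a) maintenance_data"
  assumes inst: "maintenance_instance I"
    and no_storage: "storage I = {}"
begin

lemma finite_network_arcs: "finite (arcs (network I))"
  using inst unfolding maintenance_instance_def by (meson fin_digraph.finite_arcs)

lemma finite_jobs: "finite (jobs I)"
  using inst finite_network_arcs unfolding maintenance_instance_def by (meson finite_subset)

lemma arc_cap_nonneg: "a \<in> arcs (network I) \<Longrightarrow> 0 \<le> arc_cap I a"
  using inst unfolding maintenance_instance_def by blast

lemma horizon_pos: "0 < horizon I"
  using inst unfolding maintenance_instance_def by blast

lemma job_bounds:
  assumes "a \<in> jobs I"
  shows "0 < proc_time I a" "0 \<le> release I a"
    "release I a \<le> deadline I a - proc_time I a" "deadline I a \<le> horizon I"
  using inst assms unfolding maintenance_instance_def by blast+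

section \<open>Maximum flow per unit of time when some arcs are closed\<close>

definition net_outflow :: "('a \<Rightarrow> real) \<Rightarrow> real" where
  "net_outflow x =
     (\<Sum>a\<in>out_arcs (network I) (source I). x a) - (\<Sum>a\<in>in_arcs (network I) (source I). x a)"

definition steady_flow :: "'a set \<Rightarrow> ('a \<Rightarrow> real) \<Rightarrow> bool" where
  "steady_flow D x \<longleftrightarrow>
     (\<forall>a\<in>arcs (network I). 0 \<le> x a \<and> x a \<le> (if a \<in> D then 0 else arc_cap I a)) \<and>
     (\<forall>v\<in>verts (network I) - {source I, sink I}.
        (\<Sum>a\<in>out_arcs (network I) v. x a) = (\<Sum>a\<in>in_arcs (network I) v. x a))"

definition opt_flow :: "'a set \<Rightarrow> 'a \<Rightarrow> real" where
  "opt_flow D = (SOME x. steady_flow D x \<and> (\<forall>y. steady_flow D y \<longrightarrow> net_outflow y \<le> net_outflow x))"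

definition max_flow :: "'a set \<Rightarrow> real" where
  "max_flow D = net_outflow (opt_flow D)"

text \<open>Compactness: a continuous objective attains its maximum on a closed subset of a product
  of compact intervals.\<close>

lemma max_steady_flow_exists:
  "\<exists>x. steady_flow D x \<and> (\<forall>y. steady_flow D y \<longrightarrow> net_outflow y \<le> net_outflow x)"
proof -
  let ?G = "network I"
  \<comment> \<open>Pinning the coordinates outside \<open>arcs ?G\<close> to 0 makes the box
    compact in the product over the whole type.\<close>
  define B where "B a = (if a \<in> arcs ?G then {0..(if a \<in> D then 0 else arc_cap I a)} else {0})" for a
  define cons where "cons v = {x :: 'a \<Rightarrow> real.
    (\<Sum>a\<in>out_arcs ?G v. x a) = (\<Sum>a\<in>in_arcs ?G v. x a)}" for v
  define K where "K = PiE UNIV B \<inter> (\<Inter>v\<in>verts ?G - {source I, sink I}. cons v)"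
  have "compact (PiE UNIV B)"
  proof -
    have "compactin (product_topology (\<lambda>_. euclidean) UNIV) (PiE UNIV B)"
      unfolding compactin_PiE by (auto simp: B_def)
    then show ?thesis by (simp add: euclidean_product_topology)
  qed
  moreover have "closed (cons v)" for v
    unfolding cons_def by (intro closed_Collect_eq continuous_intros continuous_on_product_coordinates)
  ultimately have "compact K"
    unfolding K_def by (intro compact_Int_closed closed_INT) auto
  moreover have "(\<lambda>_. 0) \<in> K"
    by (auto simp: K_def B_def cons_def arc_cap_nonneg PiE_def)
  moreover have "continuous_on K net_outflow"
    unfolding net_outflow_def
    by (intro continuous_intros continuous_on_subset[OF continuous_on_product_coordinates]) auto
  ultimately obtain x where x: "x \<in> K" "\<And>y. y \<in> K \<Longrightarrow> net_outflow y \<le> net_outflow x"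
    using continuous_attains_sup[of K net_outflow] by blast
  have "steady_flow D x"
    unfolding steady_flow_def
  proof (intro conjI ballI)
    fix a assume "a \<in> arcs ?G"
    moreover have "x a \<in> B a" using x(1) by (auto simp: K_def)
    ultimately show "0 \<le> x a" "x a \<le> (if a \<in> D then 0 else arc_cap I a)"
      by (auto simp: B_def)
  next
    fix v assume "v \<in> verts ?G - {source I, sink I}"
    then show "(\<Sum>a\<in>out_arcs ?G v. x a) = (\<Sum>a\<in>in_arcs ?G v. x a)"
      using x(1) by (auto simp: K_def cons_def)
  qed
  moreover have "net_outflow y \<le> net_outflow x" if y: "steady_flow D y" for y
  proof -
    \<comment> \<open>A steady flow is unconstrained off the arcs; zeroing it there puts it into
      \<open>K\<close> without changing any sum.\<close>
    define z where "z a = (if a \<in> arcs ?G then y a else 0)" for a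
    have eq: "(\<Sum>a\<in>out_arcs ?G v. z a) = (\<Sum>a\<in>out_arcs ?G v. y a)"
      "(\<Sum>a\<in>in_arcs ?G v. z a) = (\<Sum>a\<in>in_arcs ?G v. y a)" for v
      by (auto simp: z_def intro!: sum.cong)
    have "z \<in> K"
      using y by (auto simp: K_def B_def cons_def eq steady_flow_def) (auto simp: z_def)
    moreover have "net_outflow z = net_outflow y"
      by (simp add: net_outflow_def eq)
    ultimately show ?thesis using x(2) by metis
  qed
  ultimately show ?thesis by blast
qed

lemma opt_flow: "steady_flow D (opt_flow D)"
  and net_outflow_le_max_flow: "steady_flow D y \<Longrightarrow> net_outflow y \<le> max_flow D"
  using someI_ex[OF max_steady_flow_exists[of D]] unfolding opt_flow_def max_flow_def by auto

section \<open>Event times and the value of a schedule as a sum over intervals\<close>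

definition down_jobs :: "('a \<Rightarrow> real) \<Rightarrow> real \<Rightarrow> 'a set" where
  "down_jobs ts t = {a \<in> jobs I. ts a < t \<and> t \<le> ts a + proc_time I a}"

lemma finite_event_times: "finite (event_times I ts)"
  using finite_jobs by (simp add: event_times_def)

lemma event_time_image: "event_time I ts ` {0..num_intervals I ts} = event_times I ts"
proof -
  have "card (event_times I ts) \<noteq> 0"
    using finite_event_times by (auto simp: event_times_def)
  then have "{0..num_intervals I ts} = {..<card (event_times I ts)}"
    by (auto simp: num_intervals_def)
  moreover have "(!) (sorted_list_of_set (event_times I ts)) ` {..<card (event_times I ts)} = event_times I ts"
    using finite_event_times[of ts] nth_image[of _ "sorted_list_of_set (event_times I ts)"]
    by (metis length_sorted_list_of_set lessThan_atLeast0 order_refl set_sorted_list_of_set take_all)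
  ultimately show ?thesis by (simp add: event_time_def)
qed

lemma event_time_less:
  assumes "i < j" "j \<le> num_intervals I ts"
  shows "event_time I ts i < event_time I ts j"
proof -
  have "card (event_times I ts) \<noteq> 0"
    using finite_event_times by (auto simp: event_times_def)
  then have "j < length (sorted_list_of_set (event_times I ts))"
    using assms(2) by (simp add: num_intervals_def)
  then show ?thesis
    using assms(1) unfolding event_time_def by (intro sorted_wrt_nth_less[OF strict_sorted_list_of_set])
qed

lemma event_time_gap:
  assumes "s \<in> event_times I ts" "i \<in> {1..num_intervals I ts}"
  shows "s \<le> event_time I ts (i - 1) \<or> event_time I ts i \<le> s"
proof -
  obtain j where j: "j \<le> num_intervals I ts" "s = event_time I ts j"
    using assms(1) unfolding event_time_image[symmetric] by auto
  show ?thesis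
  proof (cases "j < i")
    case True
    then have "j = i - 1 \<or> j < i - 1" by linarith
    moreover have "i - 1 \<le> num_intervals I ts" using assms(2) by auto
    ultimately have "event_time I ts j \<le> event_time I ts (i - 1)"
      using event_time_less[of j "i - 1" ts] by auto
    then show ?thesis using j(2) by simp
  next
    case False
    then show ?thesis
      using j event_time_less[of i j ts] by (cases "j = i") auto
  qed
qed

text \<open>With no storage nothing links different intervals, so the constraints decouple. Dividing
  by the positive interval length turns amounts into rates.\<close>

lemma feasible_flow_iff:
  "feasible_flow I ts x y \<longleftrightarrow> (\<forall>i\<in>{1..num_intervals I ts}.
     steady_flow (down_jobs ts (event_time I ts i))
       (\<lambda>a. x a i / (event_time I ts i - event_time I ts (i - 1))))"
  (is "_ \<longleftrightarrow> (\<forall>i\<in>?N. steady_flow (?D i) (\<lambda>a. x a i / ?l i))")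
proof -
  let ?G = "network I"
  have l: "0 < ?l i" if "i \<in> ?N" for i
    using that event_time_less[of "i - 1" i ts] by auto
  have jobs: "jobs I \<subseteq> arcs ?G" using inst unfolding maintenance_instance_def by blast
  have maintained: "i \<in> maintained I ts a \<longleftrightarrow> a \<in> ?D i" if "i \<in> ?N" "a \<in> jobs I" for a i
    using that by (auto simp: maintained_def down_jobs_def)
  have maintained_sub: "maintained I ts a \<subseteq> ?N" for a
    by (auto simp: maintained_def)
  have D: "?D i \<subseteq> jobs I" for i by (auto simp: down_jobs_def)
  \<comment> \<open>First the constraints are only regrouped by interval, still in terms of amounts;
    the scaling follows afterwards.\<close>
  have "feasible_flow I ts x y \<longleftrightarrow> (\<forall>i\<in>?N.
       (\<forall>a\<in>arcs ?G. 0 \<le> x a i \<and> x a i \<le> (if a \<in> ?D i then 0 else ?l i * arc_cap I a)) \<and>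
       (\<forall>v\<in>verts ?G - {source I, sink I}.
          (\<Sum>a\<in>out_arcs ?G v. x a i) = (\<Sum>a\<in>in_arcs ?G v. x a i)))" (is "_ = ?R")
  proof
    assume f: "feasible_flow I ts x y"
    show ?R
    proof (intro ballI conjI)
      fix i a assume i: "i \<in> ?N" and a: "a \<in> arcs ?G"
      show "0 \<le> x a i" using f i a unfolding feasible_flow_def Let_def by blast
      show "x a i \<le> (if a \<in> ?D i then 0 else ?l i * arc_cap I a)"
      proof (cases "a \<in> ?D i")
        case True
        then have "a \<in> jobs I" "i \<in> maintained I ts a" using maintained[OF i] D by auto
        then have "x a i = 0" using f unfolding feasible_flow_def Let_def by blast
        then show ?thesis using True by simp
      next
        case False
        then have "a \<notin> jobs I \<or> i \<notin> maintained I ts a" using maintained[OF i] by auto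
        then have "x a i \<le> ?l i * arc_cap I a"
          using f i a unfolding feasible_flow_def Let_def by blast
        then show ?thesis using False by simp
      qed
    next
      fix i v assume "i \<in> ?N" "v \<in> verts ?G - {source I, sink I}"
      then show "(\<Sum>a\<in>out_arcs ?G v. x a i) = (\<Sum>a\<in>in_arcs ?G v. x a i)"
        using f no_storage unfolding feasible_flow_def Let_def by simp
    qed
  next
    assume R: ?R
    have "x a i = 0" if "a \<in> jobs I" "i \<in> maintained I ts a" for a i
    proof -
      have i: "i \<in> ?N" using that maintained_sub by blast
      then have "a \<in> ?D i" using that maintained by blast
      moreover have "a \<in> arcs ?G" using that jobs by blast
      ultimately have "0 \<le> x a i" "x a i \<le> (if a \<in> ?D i then 0 else ?l i * arc_cap I a)"
        using R i by blast+
      then show ?thesis using \<open>a \<in> ?D i\<close> by simp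
    qed
    moreover have "x a i \<le> ?l i * arc_cap I a"
      if "a \<in> arcs ?G" "i \<in> ?N" "a \<notin> jobs I \<or> i \<notin> maintained I ts a" for a i
    proof -
      have "a \<notin> ?D i" using that maintained D by blast
      moreover have "x a i \<le> (if a \<in> ?D i then 0 else ?l i * arc_cap I a)"
        using R that by blast
      ultimately show ?thesis by simp
    qed
    ultimately show "feasible_flow I ts x y"
      using R no_storage unfolding feasible_flow_def Let_def by auto
  qed
  also have "\<dots> \<longleftrightarrow> (\<forall>i\<in>?N. steady_flow (?D i) (\<lambda>a. x a i / ?l i))"
  proof (intro ball_cong refl)
    fix i assume "i \<in> ?N"
    then have l: "0 < ?l i" by (rule l)
    have le: "x a i / ?l i \<le> (if a \<in> ?D i then 0 else arc_cap I a) \<longleftrightarrow>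
       x a i \<le> (if a \<in> ?D i then 0 else ?l i * arc_cap I a)" for a
      using l by (auto simp: pos_divide_le_eq mult.commute)
    have ge: "0 \<le> x a i / ?l i \<longleftrightarrow> 0 \<le> x a i" for a
      using l by (simp add: zero_le_divide_iff)
    have "(\<Sum>a\<in>S. x a i / ?l i) = (\<Sum>a\<in>S. x a i) / ?l i" for S
      by (simp add: sum_divide_distrib)
    then have "(\<Sum>a\<in>S. x a i / ?l i) = (\<Sum>a\<in>S'. x a i / ?l i) \<longleftrightarrow>
       (\<Sum>a\<in>S. x a i) = (\<Sum>a\<in>S'. x a i)" for S S'
      using l by simp
    then show "((\<forall>a\<in>arcs ?G. 0 \<le> x a i \<and> x a i \<le> (if a \<in> ?D i then 0 else ?l i * arc_cap I a)) \<and>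
       (\<forall>v\<in>verts ?G - {source I, sink I}.
          (\<Sum>a\<in>out_arcs ?G v. x a i) = (\<Sum>a\<in>in_arcs ?G v. x a i))) \<longleftrightarrow>
       steady_flow (?D i) (\<lambda>a. x a i / ?l i)"
      unfolding steady_flow_def le ge by simp
  qed
  finally show ?thesis .
qed

lemma throughput_eq:
  "throughput I ts x = (\<Sum>i = 1..num_intervals I ts. (event_time I ts i - event_time I ts (i - 1)) *
     net_outflow (\<lambda>a. x a i / (event_time I ts i - event_time I ts (i - 1))))"
  unfolding throughput_def
proof (intro sum.cong refl)
  fix i assume "i \<in> {1..num_intervals I ts}"
  then have "0 < event_time I ts i - event_time I ts (i - 1)"
    using event_time_less[of "i - 1" i ts] by auto
  then show "(\<Sum>a\<in>out_arcs (network I) (source I). x a i) - (\<Sum>a\<in>in_arcs (network I) (source I). x a i) =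
      (event_time I ts i - event_time I ts (i - 1)) *
      net_outflow (\<lambda>a. x a i / (event_time I ts i - event_time I ts (i - 1)))"
    by (simp add: net_outflow_def flip: sum_divide_distrib diff_divide_distrib)
qed

lemma schedule_value_eq:
  "schedule_value I ts = (\<Sum>i = 1..num_intervals I ts. (event_time I ts i - event_time I ts (i - 1)) *
     max_flow (down_jobs ts (event_time I ts i)))"
  unfolding schedule_value_def
proof (rule Greatest_equality)
  let ?l = "\<lambda>i. event_time I ts i - event_time I ts (i - 1)"
  let ?D = "\<lambda>i. down_jobs ts (event_time I ts i)"
  have l: "0 < ?l i" if "i \<in> {1..num_intervals I ts}" for i
    using that event_time_less[of "i - 1" i ts] by auto
  \<comment> \<open>An optimal steady flow is run at constant rate throughout each interval, which
    attains the claimed maximum.\<close>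
  define x where "x a i = ?l i * opt_flow (?D i) a" for a i
  have x: "(\<lambda>a. x a i / ?l i) = opt_flow (?D i)" if "i \<in> {1..num_intervals I ts}" for i
    using l[OF that] by (auto simp: x_def)
  have "feasible_flow I ts x (\<lambda>_ _. 0)"
    unfolding feasible_flow_iff using x opt_flow by simp
  moreover have "(\<Sum>i = 1..num_intervals I ts. ?l i * max_flow (?D i)) = throughput I ts x"
    unfolding throughput_eq max_flow_def by (intro sum.cong refl) (simp only: x)
  ultimately show "\<exists>x y. feasible_flow I ts x y \<and>
      (\<Sum>i = 1..num_intervals I ts. ?l i * max_flow (?D i)) = throughput I ts x"
    by blast
  fix z assume "\<exists>x y. feasible_flow I ts x y \<and> z = throughput I ts x"
  then obtain x y where "feasible_flow I ts x y" and z: "z = throughput I ts x" by blast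
  then show "z \<le> (\<Sum>i = 1..num_intervals I ts. ?l i * max_flow (?D i))"
    unfolding z throughput_eq feasible_flow_iff
    by (intro sum_mono mult_left_mono net_outflow_le_max_flow) (blast, blast intro: l less_imp_le)
qed

section \<open>The value of a schedule as an integral over time\<close>

lemma job_events_mem:
  assumes "a \<in> jobs I"
  shows "ts a \<in> event_times I ts" "ts a + proc_time I a \<in> event_times I ts"
  using assms by (auto simp: event_times_def)

lemma schedules_window:
  assumes "ts \<in> schedules I" "a \<in> jobs I"
  shows "release I a \<le> ts a" "ts a \<le> deadline I a - proc_time I a"
  using PiE_mem[OF assms[unfolded schedules_def]] by (auto simp: start_window_def)

lemma event_times_bounds:
  assumes "ts \<in> schedules I" "e \<in> event_times I ts"
  shows "0 \<le> e" "e \<le> horizon I"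
proof -
  have "0 \<le> ts a \<and> ts a + proc_time I a \<le> horizon I \<and> 0 < proc_time I a" if "a \<in> jobs I" for a
    using schedules_window[OF assms(1) that] job_bounds[OF that] by linarith
  then show "0 \<le> e" "e \<le> horizon I"
    using assms(2) horizon_pos by (force simp: event_times_def)+
qed

lemma event_time_ends:
  assumes "ts \<in> schedules I"
  shows "event_time I ts 0 = 0" "event_time I ts (num_intervals I ts) = horizon I"
proof -
  let ?n = "num_intervals I ts"
  have "event_time I ts 0 \<in> event_times I ts" "event_time I ts ?n \<in> event_times I ts"
    unfolding event_time_image[symmetric] by auto
  then have b: "0 \<le> event_time I ts 0" "event_time I ts ?n \<le> horizon I"
    using event_times_bounds[OF assms] by auto
  have mono: "event_time I ts i \<le> event_time I ts j" if "i \<le> j" "j \<le> ?n" for i j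
    using that event_time_less[of i j ts] by (cases "i = j") auto
  have "0 \<in> event_times I ts" "horizon I \<in> event_times I ts"
    by (auto simp: event_times_def)
  then obtain i j where "i \<le> ?n" "0 = event_time I ts i" "j \<le> ?n" "horizon I = event_time I ts j"
    unfolding event_time_image[symmetric] by auto
  then show "event_time I ts 0 = 0" "event_time I ts ?n = horizon I"
    using b mono[of 0 i] mono[of j ?n] by auto
qed

text \<open>
  The map \<open>h\<close> need only be weakly monotone: intervals that it collapses contribute nothing.
\<close>

lemma has_integral_transported:
  assumes ts: "ts \<in> schedules I"
    and mono: "\<And>e e'. \<lbrakk>e \<in> event_times I ts; e' \<in> event_times I ts; e < e'\<rbrakk> \<Longrightarrow> h e \<le> h e'"
    and ends: "h 0 = 0" "h (horizon I) = horizon I"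
    and jobs: "\<And>a. a \<in> jobs I \<Longrightarrow> h (ts a) = ts' a"
      "\<And>a. a \<in> jobs I \<Longrightarrow> h (ts a + proc_time I a) = ts' a + proc_time I a"
  shows "((\<lambda>t. max_flow (down_jobs ts' t)) has_integral
     (\<Sum>i = 1..num_intervals I ts. (h (event_time I ts i) - h (event_time I ts (i - 1))) *
        max_flow (down_jobs ts (event_time I ts i)))) {0..horizon I}"
proof -
  let ?n = "num_intervals I ts" and ?e = "event_time I ts"
  have mem: "?e i \<in> event_times I ts" if "i \<le> ?n" for i
    unfolding event_time_image[symmetric] using that by auto
  have mono': "h e \<le> h e'" if "e \<in> event_times I ts" "e' \<in> event_times I ts" "e \<le> e'" for e e'
    using mono[of e e'] that by (cases "e = e'") auto
  have "?e (i - 1) < ?e i" if "i \<in> {1..?n}" for i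
    using that by (intro event_time_less) auto
  then have le: "h (?e (i - 1)) \<le> h (?e i)" if "i \<in> {1..?n}" for i
    using that by (intro mono mem) auto
  \<comment> \<open>For \<open>t\<close> strictly inside the image of an interval, the events of
    \<open>ts'\<close> lie on the same side of \<open>t\<close> as the corresponding events of
    \<open>ts\<close> relative to that interval.\<close>
  have "down_jobs ts' t = down_jobs ts (?e i)"
    if i: "i \<in> {1..?n}" and t: "h (?e (i - 1)) < t" "t < h (?e i)" for i t
  proof -
    have less: "?e (i - 1) < ?e i" using i by (intro event_time_less) auto
    have iff: "h s < t \<longleftrightarrow> s < ?e i" if s: "s \<in> event_times I ts" for s
      using event_time_gap[OF s i]
    proof
      assume "s \<le> ?e (i - 1)"
      moreover from this have "h s \<le> h (?e (i - 1))" using i by (intro mono' s mem) auto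
      ultimately show ?thesis using t less by linarith
    next
      assume "?e i \<le> s"
      moreover from this have "h (?e i) \<le> h s" using i by (intro mono' s mem) auto
      ultimately show ?thesis using t less by linarith
    qed
    have iff': "t \<le> h s \<longleftrightarrow> ?e i \<le> s" if s: "s \<in> event_times I ts" for s
      using iff[OF s] by linarith
    have "ts' a < t \<longleftrightarrow> ts a < ?e i" "t \<le> ts' a + proc_time I a \<longleftrightarrow> ?e i \<le> ts a + proc_time I a"
      if "a \<in> jobs I" for a
      using iff[OF job_events_mem(1)[OF that]] iff'[OF job_events_mem(2)[OF that]] jobs[OF that] by auto
    then show ?thesis unfolding down_jobs_def by blast
  qed
  then have "((\<lambda>t. max_flow (down_jobs ts' t)) has_integral
     (\<Sum>i = 1..?n. (h (?e i) - h (?e (i - 1))) * max_flow (down_jobs ts (?e i)))) {h (?e 0)..h (?e ?n)}"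
    using has_integral_step_function[where f = "\<lambda>i. h (?e i)" and n = ?n
        and g = "\<lambda>t. max_flow (down_jobs ts' t)" and c = "\<lambda>i. max_flow (down_jobs ts (?e i))"] le
    by auto
  then show ?thesis by (simp add: event_time_ends[OF ts] ends)
qed

text \<open>The case where \<open>h\<close> is the identity. Since integrals are unique, the value
  of a moved schedule can then be computed on the intervals of the original one.\<close>

lemma has_integral_schedule_value:
  assumes "ts \<in> schedules I"
  shows "((\<lambda>t. max_flow (down_jobs ts t)) has_integral schedule_value I ts) {0..horizon I}"
  unfolding schedule_value_eq using has_integral_transported[OF assms, of "\<lambda>e. e" ts] by simp

section \<open>Coincidences of jobs and the shifting argument\<close>

definition job_events :: "('a \<Rightarrow> real) \<Rightarrow> 'a \<Rightarrow> real set" where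
  "job_events ts a = {ts a, ts a + proc_time I a}"

definition anchored :: "('a \<Rightarrow> real) \<Rightarrow> 'a \<Rightarrow> bool" where
  "anchored ts a \<longleftrightarrow> ts a = release I a \<or> ts a = deadline I a - proc_time I a"

definition coincident_pairs :: "('a \<Rightarrow> real) \<Rightarrow> ('a \<times> 'a) set" where
  "coincident_pairs ts = {(a, b). a \<in> jobs I \<and> b \<in> jobs I \<and> job_events ts a \<inter> job_events ts b \<noteq> {}}"

text \<open>A bounded potential that every shift increases. Pairs are ordered and include the
  diagonal, which is harmless because only comparisons and an upper bound are used.\<close>

definition rank :: "('a \<Rightarrow> real) \<Rightarrow> nat" where
  "rank ts = card (coincident_pairs ts) + card {a \<in> jobs I. anchored ts a}"

lemma coincident_pairs_subset: "coincident_pairs ts \<subseteq> jobs I \<times> jobs I"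
  by (auto simp: coincident_pairs_def)

lemma rank_le: "rank ts \<le> card (jobs I \<times> jobs I) + card (jobs I)"
  unfolding rank_def
  using finite_jobs by (intro add_mono card_mono coincident_pairs_subset) auto

text \<open>The value is affine in the displacement up to the first critical one, so one of the two
  directions loses nothing. The strict growth of \<open>rank\<close> rules out repeating the move
  forever.\<close>

lemma shift_free_jobs:
  assumes ts: "ts \<in> schedules I"
    and C: "C \<subseteq> jobs I" "C \<noteq> {}"
    and separate: "\<And>a b. \<lbrakk>a \<in> C; b \<in> jobs I - C\<rbrakk> \<Longrightarrow> job_events ts a \<inter> job_events ts b = {}"
    and free: "\<And>a. a \<in> C \<Longrightarrow> \<not> anchored ts a"
  shows "\<exists>ts'\<in>schedules I. schedule_value I ts \<le> schedule_value I ts' \<and> rank ts < rank ts'"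
proof -
  let ?n = "num_intervals I ts" and ?e = "event_time I ts"
  define M where "M = (\<Union>a\<in>C. job_events ts a)"
  define R where "R = (\<Union>a\<in>jobs I - C. job_events ts a)"
  define ind :: "real \<Rightarrow> real" where "ind e = of_bool (e \<in> M)" for e
  \<comment> \<open>The slope of the value: per unit of displacement, an interval gains length at a
    moving right end and loses it at a moving left end.\<close>
  define K where "K = (\<Sum>i = 1..?n. (ind (?e i) - ind (?e (i - 1))) * max_flow (down_jobs ts (?e i)))"
  \<comment> \<open>the displacements at which the combinatorial structure of the schedule changes\<close>
  define crit where "crit = (\<lambda>(e, e'). e' - e) ` (M \<times> R) \<union> (\<lambda>a. release I a - ts a) ` C
     \<union> (\<lambda>a. deadline I a - proc_time I a - ts a) ` C"
  have "finite C" using C(1) finite_jobs finite_subset by blast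
  then have "finite M" "finite R"
    using finite_jobs by (auto simp: M_def R_def job_events_def)
  then have fin: "finite crit" using \<open>finite C\<close> by (auto simp: crit_def)
  have MR: "M \<inter> R = {}" using separate by (auto simp: M_def R_def)
  have window: "release I a < ts a" "ts a < deadline I a - proc_time I a" if "a \<in> C" for a
    using schedules_window[OF ts, of a] free[OF that] that C(1) by (auto simp: anchored_def)
  \<comment> \<open>The shortest critical displacement in a direction that does not lower the value.
    One exists because the two window ends of any job in \<open>C\<close> give critical
    displacements of opposite signs.\<close>
  obtain l where l: "l \<in> crit" "0 \<le> l * K" "\<And>c. \<lbrakk>c \<in> crit; 0 \<le> c * K\<rbrakk> \<Longrightarrow> \<bar>l\<bar> \<le> \<bar>c\<bar>"
  proof -
    let ?P = "{c \<in> crit. 0 \<le> c * K}"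
    obtain a where a: "a \<in> C" using C(2) by blast
    then have "release I a - ts a \<in> crit" "deadline I a - proc_time I a - ts a \<in> crit"
      by (auto simp: crit_def)
    moreover have "0 \<le> (release I a - ts a) * K \<or> 0 \<le> (deadline I a - proc_time I a - ts a) * K"
      using window[OF a] by (auto simp: zero_le_mult_iff)
    ultimately have "?P \<noteq> {}" by blast
    moreover have "finite ?P" using fin by simp
    ultimately obtain l where "is_arg_min abs (\<lambda>c. c \<in> ?P) l"
      using ex_is_arg_min_if_finite by blast
    then show thesis by (intro that[of l]) (auto simp: is_arg_min_linorder)
  qed
  \<comment> \<open>A critical \<open>c\<close> strictly between 0 and \<open>l\<close> would share
    the sign of \<open>l\<close> and contradict its minimality.\<close>
  have gap: "\<not> (0 < c \<and> c < l)" "\<not> (l < c \<and> c < 0)" if c: "c \<in> crit" for c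
  proof -
    show "\<not> (0 < c \<and> c < l)"
    proof
      assume *: "0 < c \<and> c < l"
      then have "0 \<le> c * K" using l(2) by (auto simp: zero_le_mult_iff)
      then show False using l(3)[OF c] * by linarith
    qed
    show "\<not> (l < c \<and> c < 0)"
    proof
      assume *: "l < c \<and> c < 0"
      then have "0 \<le> c * K" using l(2) by (auto simp: zero_le_mult_iff)
      then show False using l(3)[OF c] * by linarith
    qed
  qed
  define ts' where "ts' a = (if a \<in> C then ts a + l else ts a)" for a
  define h where "h e = e + l * ind e" for e
  have window': "release I a \<le> ts a + l" "ts a + l \<le> deadline I a - proc_time I a" if "a \<in> C" for a
  proof -
    have "release I a - ts a \<in> crit" "deadline I a - proc_time I a - ts a \<in> crit"
      using that by (auto simp: crit_def)
    then show "release I a \<le> ts a + l" "ts a + l \<le> deadline I a - proc_time I a"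
      using gap window[OF that] by fastforce+
  qed
  have ts': "ts' \<in> schedules I"
    using ts C(1) window' by (auto simp: schedules_def ts'_def start_window_def PiE_iff extensional_def)
  \<comment> \<open>The strict bounds keep 0 and the horizon out of \<open>M\<close>, so
    \<open>h\<close> fixes them; the weak ones keep moved events from passing them.\<close>
  have M_bounds: "0 < e \<and> e < horizon I \<and> 0 \<le> e + l \<and> e + l \<le> horizon I" if e: "e \<in> M" for e
  proof -
    obtain a where "a \<in> C" "e = ts a \<or> e = ts a + proc_time I a"
      using e by (auto simp: M_def job_events_def)
    then show ?thesis using window[of a] window'[of a] job_bounds[of a] C(1) by force
  qed
  have h_M: "h e = e + l" if "e \<in> M" for e using that by (simp add: h_def ind_def)
  have h_fixed: "h e = e" if "e \<notin> M" for e using that by (simp add: h_def ind_def)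
  have events: "e \<in> M \<or> e \<in> R \<or> e = 0 \<or> e = horizon I" if "e \<in> event_times I ts" for e
    using that by (auto simp: event_times_def M_def R_def job_events_def)
  \<comment> \<open>Order could only be reversed between a moved and a fixed event. For a fixed job
    event the difference is critical, so \<open>gap\<close> allows the two to meet but not to
    cross.\<close>
  have mono: "h e \<le> h e'" if e: "e \<in> event_times I ts" "e' \<in> event_times I ts" "e < e'" for e e'
  proof -
    consider "e \<in> M" "e' \<in> M" | "e \<notin> M" "e' \<notin> M" | "e \<in> M" "e' \<in> R" | "e \<in> R" "e' \<in> M"
      | "e \<in> M" "e' \<notin> M" "e' = 0 \<or> e' = horizon I" | "e \<notin> M" "e' \<in> M" "e = 0 \<or> e = horizon I"
      using events[OF e(1)] events[OF e(2)] by blast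
    then show ?thesis
    proof cases
      case 3
      then have "e' - e \<in> crit" by (force simp: crit_def)
      then show ?thesis using gap(1) e(3) 3 h_M[of e] h_fixed[of e'] MR by fastforce
    next
      case 4
      then have "e - e' \<in> crit" by (force simp: crit_def)
      then show ?thesis using gap(2) e(3) 4 h_M[of e'] h_fixed[of e] MR by fastforce
    qed (use e(3) h_M h_fixed M_bounds in fastforce)+
  qed
  have "((\<lambda>t. max_flow (down_jobs ts' t)) has_integral
     (\<Sum>i = 1..?n. (h (?e i) - h (?e (i - 1))) * max_flow (down_jobs ts (?e i)))) {0..horizon I}"
  proof (rule has_integral_transported[OF ts mono])
    show "h 0 = 0" "h (horizon I) = horizon I"
      using M_bounds h_fixed by blast+
    fix a assume "a \<in> jobs I"
    then have "job_events ts a \<subseteq> M \<and> a \<in> C \<or> job_events ts a \<inter> M = {} \<and> a \<notin> C"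
      using MR by (auto simp: M_def R_def)
    then show "h (ts a) = ts' a" "h (ts a + proc_time I a) = ts' a + proc_time I a"
      by (auto simp: job_events_def ts'_def h_M h_fixed)
  qed
  then have "schedule_value I ts' =
     (\<Sum>i = 1..?n. (h (?e i) - h (?e (i - 1))) * max_flow (down_jobs ts (?e i)))"
    using has_integral_unique has_integral_schedule_value[OF ts'] by blast
  also have "\<dots> = schedule_value I ts + l * K"
    unfolding schedule_value_eq K_def h_def sum_distrib_left sum.distrib[symmetric]
    by (intro sum.cong refl) (simp add: algebra_simps)
  finally have better: "schedule_value I ts \<le> schedule_value I ts'" using l(2) by simp
  have sub1: "coincident_pairs ts \<subseteq> coincident_pairs ts'"
  proof
    fix q assume "q \<in> coincident_pairs ts"
    then obtain a b where q: "q = (a, b)" "a \<in> jobs I" "b \<in> jobs I"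
      "job_events ts a \<inter> job_events ts b \<noteq> {}" by (auto simp: coincident_pairs_def)
    \<comment> \<open>Coincident jobs therefore move together or both stay, and their coincidence
      survives.\<close>
    then have "a \<in> C \<longleftrightarrow> b \<in> C" using separate[of a b] separate[of b a] by blast
    then show "q \<in> coincident_pairs ts'"
      using q by (auto simp: coincident_pairs_def job_events_def ts'_def)
  qed
  have sub2: "{a \<in> jobs I. anchored ts a} \<subseteq> {a \<in> jobs I. anchored ts' a}"
    using free by (auto simp: anchored_def ts'_def)
  have fin1: "finite (coincident_pairs ts')"
    using coincident_pairs_subset finite_jobs by (meson finite_SigmaI finite_subset)
  have fin2: "finite {a \<in> jobs I. anchored ts' a}" using finite_jobs by simp
  \<comment> \<open>Since \<open>l\<close> is itself critical, the shift ends at a window end or at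
    a meeting with a job outside \<open>C\<close>.\<close>
  have "(\<exists>a\<in>C. anchored ts' a) \<or> (\<exists>a\<in>C. \<exists>b\<in>jobs I - C. job_events ts' a \<inter> job_events ts' b \<noteq> {})"
    using l(1) unfolding crit_def
  proof (elim UnE)
    assume "l \<in> (\<lambda>(e, e'). e' - e) ` (M \<times> R)"
    then obtain a b e e' where ab: "a \<in> C" "b \<in> jobs I - C" "e \<in> job_events ts a"
      "e' \<in> job_events ts b" "l = e' - e" by (auto simp: M_def R_def)
    then have "e' \<in> job_events ts' a \<inter> job_events ts' b"
      by (auto simp: job_events_def ts'_def)
    then show ?thesis using ab by blast
  qed (fastforce simp: anchored_def ts'_def)+
  then have "rank ts < rank ts'"
  proof
    assume "\<exists>a\<in>C. anchored ts' a"
    then have "{a \<in> jobs I. anchored ts a} \<subset> {a \<in> jobs I. anchored ts' a}"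
      using sub2 free C(1) by blast
    then show ?thesis
      unfolding rank_def by (intro add_le_less_mono card_mono psubset_card_mono sub1 fin1 fin2)
  next
    assume "\<exists>a\<in>C. \<exists>b\<in>jobs I - C. job_events ts' a \<inter> job_events ts' b \<noteq> {}"
    then obtain a b where "a \<in> C" "b \<in> jobs I - C" "job_events ts' a \<inter> job_events ts' b \<noteq> {}"
      by blast
    then have "(a, b) \<in> coincident_pairs ts' - coincident_pairs ts"
      using C(1) separate[of a b] by (auto simp: coincident_pairs_def)
    then have "coincident_pairs ts \<subset> coincident_pairs ts'" using sub1 by blast
    then show ?thesis
      unfolding rank_def by (intro add_less_le_mono card_mono psubset_card_mono sub2 fin1 fin2)
  qed
  then show ?thesis using ts' better by blast
qed

section \<open>Candidate start times and existence of an optimum among them\<close>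

lemma candidates_adjacent:
  assumes ts: "ts \<in> schedules I" and ab: "a \<in> jobs I" "b \<in> jobs I" "a \<noteq> b"
    and "ts b \<in> candidates I k b" "job_events ts a \<inter> job_events ts b \<noteq> {}"
  shows "ts a \<in> candidates I (Suc k) a"
proof -
  \<comment> \<open>The cases start-start, start-end, end-start and end-end match the four sets in
    the recursion for \<open>candidates\<close>.\<close>
  have "ts a = ts b \<or> ts a = ts b + proc_time I b \<or> ts a = ts b - proc_time I a
      \<or> ts a = ts b + (proc_time I b - proc_time I a)"
    using assms(6) by (auto simp: job_events_def)
  moreover have "ts a \<in> start_window I a"
    using PiE_mem[OF ts[unfolded schedules_def] ab(1)] .
  ultimately show ?thesis
    using ab assms(5) by (force simp: translate_def)
qed

text \<open>Candidacy spreads from anchored jobs along coincidences, and each round reaches at least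
  one further job until all are reached.\<close>

lemma rigid_schedule_candidates:
  assumes ts: "ts \<in> schedules I"
    and rigid: "\<And>C. \<lbrakk>C \<subseteq> jobs I; C \<noteq> {};
       \<And>a b. \<lbrakk>a \<in> C; b \<in> jobs I - C\<rbrakk> \<Longrightarrow> job_events ts a \<inter> job_events ts b = {}\<rbrakk>
       \<Longrightarrow> \<exists>a\<in>C. anchored ts a"
    and a: "a \<in> jobs I"
  shows "ts a \<in> candidate_starts I a"
proof -
  define P where "P k = {a \<in> jobs I. ts a \<in> candidates I k a}" for k
  have fin: "finite (P k)" for k using finite_jobs by (simp add: P_def)
  have mono: "P k \<subseteq> P (Suc k)" for k by (auto simp: P_def)
  have anchored: "{a \<in> jobs I. anchored ts a} \<subseteq> P k" for k
    by (induction k) (use mono in \<open>auto simp: P_def anchored_def\<close>)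
  \<comment> \<open>Starting from a nonempty \<open>P 0\<close>, this count makes
    \<open>card (jobs I) - 1\<close> rounds sufficient.\<close>
  have "P k = jobs I \<or> k < card (P k)" for k
  proof (induction k)
    case 0
    have "\<exists>a\<in>jobs I. anchored ts a" using rigid[of "jobs I"] a by blast
    then have "P 0 \<noteq> {}" using anchored[of 0] by blast
    then show ?case using fin by (simp add: card_gt_0_iff)
  next
    case (Suc k)
    show ?case
    proof (cases "P k = jobs I")
      case True
      then show ?thesis using mono[of k] by (auto simp: P_def)
    next
      case False
      \<comment> \<open>All anchored jobs lie in \<open>P k\<close>, so rigidity of the complement
        forces a coincidence between it and \<open>P k\<close>.\<close>
      have "\<not> (\<exists>a\<in>jobs I - P k. anchored ts a)" using anchored[of k] by blast
      moreover have "jobs I - P k \<noteq> {}" using False by (auto simp: P_def)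
      ultimately obtain a b where "a \<in> jobs I - P k" "b \<in> jobs I - (jobs I - P k)"
        "job_events ts a \<inter> job_events ts b \<noteq> {}"
        using rigid[of "jobs I - P k"] by blast
      then have "a \<in> P (Suc k) - P k"
        using candidates_adjacent[OF ts, of a b k] unfolding P_def by blast
      then have "P k \<subset> P (Suc k)" using mono by blast
      then have "card (P k) < card (P (Suc k))" by (intro psubset_card_mono fin)
      then show ?thesis using Suc.IH False by auto
    qed
  qed
  from this[of "card (jobs I) - 1"] have "P (card (jobs I) - 1) = jobs I"
  proof
    assume "card (jobs I) - 1 < card (P (card (jobs I) - 1))"
    then have "card (jobs I) \<le> card (P (card (jobs I) - 1))" by linarith
    then show ?thesis using finite_jobs by (intro card_seteq) (auto simp: P_def)
  qed
  then show ?thesis using a by (auto simp: P_def candidate_starts_def)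
qed

text \<open>Among the schedules at least as good as \<open>ts\<close>, one of maximal
  \<open>rank\<close> admits no further shift and is therefore rigid.\<close>

lemma candidate_schedule_dominates:
  assumes ts: "ts \<in> schedules I"
  shows "\<exists>ts'\<in>schedules I. schedule_value I ts \<le> schedule_value I ts' \<and>
     (\<forall>a\<in>jobs I. ts' a \<in> candidate_starts I a)"
proof -
  let ?P = "\<lambda>ts'. ts' \<in> schedules I \<and> schedule_value I ts \<le> schedule_value I ts'"
  obtain ts' where ts': "?P ts'" "\<And>t. ?P t \<Longrightarrow> rank t \<le> rank ts'"
    using ex_has_greatest_nat[of ?P ts rank "Suc (card (jobs I \<times> jobs I) + card (jobs I))"]
      ts rank_le by (auto simp: less_Suc_eq_le)
  have "ts' a \<in> candidate_starts I a" if "a \<in> jobs I" for a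
  proof (rule rigid_schedule_candidates[OF _ _ that])
    show "ts' \<in> schedules I" using ts' by blast
    fix C assume C: "C \<subseteq> jobs I" "C \<noteq> {}"
      "\<And>a b. \<lbrakk>a \<in> C; b \<in> jobs I - C\<rbrakk> \<Longrightarrow> job_events ts' a \<inter> job_events ts' b = {}"
    show "\<exists>a\<in>C. anchored ts' a"
    proof (rule ccontr)
      assume "\<not> (\<exists>a\<in>C. anchored ts' a)"
      then obtain t where "t \<in> schedules I" "schedule_value I ts' \<le> schedule_value I t"
        "rank ts' < rank t"
        using shift_free_jobs[OF _ C] ts'(1) by blast
      then show False using ts' by force
    qed
  qed
  then show ?thesis using ts'(1) by blast
qed

lemma finite_candidates: "a \<in> jobs I \<Longrightarrow> finite (candidates I k a)"
proof (induction k arbitrary: a)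
  case (Suc k)
  then show ?case using finite_jobs by (auto simp: translate_def)
qed simp

lemma optimal_candidate_schedule:
  "\<exists>ts. optimal_schedule I ts \<and> (\<forall>a\<in>jobs I. ts a \<in> candidate_starts I a)"
proof -
  define Q where "Q = {ts \<in> schedules I. \<forall>a\<in>jobs I. ts a \<in> candidate_starts I a}"
  \<comment> \<open>Schedules are \<open>undefined\<close> off \<open>jobs I\<close>, so finitely
    many candidates per job leave finitely many functions.\<close>
  have "Q \<subseteq> (\<Pi>\<^sub>E a\<in>jobs I. candidate_starts I a)"
    unfolding Q_def schedules_def by (intro subsetI PiE_I) (blast, blast dest: PiE_arb)
  moreover have "finite (\<Pi>\<^sub>E a\<in>jobs I. candidate_starts I a)"
    using finite_candidates by (intro finite_PiE finite_jobs) (simp add: candidate_starts_def)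
  ultimately have fin: "finite Q" by (rule finite_subset)
  have dom: "\<exists>ts'\<in>Q. schedule_value I ts \<le> schedule_value I ts'" if "ts \<in> schedules I" for ts
    using candidate_schedule_dominates[OF that] by (auto simp: Q_def)
  \<comment> \<open>Some schedule has to exist for domination to yield a member of \<open>Q\<close>;
    starting every job at its release time is one.\<close>
  have "(\<lambda>a\<in>jobs I. release I a) \<in> schedules I"
    using job_bounds(3) by (auto simp: schedules_def start_window_def)
  then have "Q \<noteq> {}" using dom by blast
  then obtain ts where ts: "ts \<in> Q" "\<And>t. t \<in> Q \<Longrightarrow> schedule_value I t \<le> schedule_value I ts"
    using ex_is_arg_min_if_finite[OF fin, of "\<lambda>t. - schedule_value I t"]
    by (auto simp: is_arg_min_linorder)
  have "schedule_value I t \<le> schedule_value I ts" if t: "t \<in> schedules I" for t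
  proof -
    obtain t' where "t' \<in> Q" "schedule_value I t \<le> schedule_value I t'"
      using dom[OF t] by blast
    then show ?thesis using ts(2)[of t'] by linarith
  qed
  then have "optimal_schedule I ts"
    using ts(1) by (simp add: optimal_schedule_def Q_def)
  then show ?thesis using ts(1) by (auto simp: Q_def)
qed

end

theorem lemma2:
  fixes I :: "('v, 'a) maintenance_data"
  assumes "maintenance_instance I"
    and "storage I = {}"
  shows "\<exists>ts. optimal_schedule I ts \<and> (\<forall>a\<in>jobs I. ts a \<in> candidate_starts I a)"
  by (rule storage_free_maintenance.optimal_candidate_schedule[OF storage_free_maintenance.intro[OF assms]])

end
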